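(* Let $\omega\in\mathbb{R}^n$ be generic (i.e. $\mathrm{in}_\omega(I_{\mathcal A})$ and $\mathrm{in}_\omega(I_{\mathcal C_{\mathcal A}})$ are both monomial ideals). Let $\mathbf u\in\mathbb{N}^n$ and let $\sigma$ be a face of the regular triangulation $\Delta_\omega$ such that $\mathrm{supp}(\mathbf u)\cap\sigma=\emptyset$. Then $(\mathbf x^{\mathbf u},\sigma)$ is a standard pair of $\mathrm{in}_\omega(I_{\mathcal C_{\mathcal A}})$ if and only if the following two conditions hold. (1) For each non-zero lattice point $\mathbf z\in\mathbb{Z}^{n-d}$ in $Q_{\mathbf u,\omega}^{\bar\sigma}$, $\mathbf x^{\mathbf u+\mathbf m_{\mathbf z}}-\mathbf x^{\mathbf u+\mathbf m_{\mathbf z}-B\mathbf z}\notin (I_{\mathcal C_{\mathcal A}}:\mathbf x_\sigma^\infty)$. (2) For each $i\in\bar\sigma$, there exists some non-zero lattice point $\mathbf z\in\mathbb{Z}^{n-d}$ in $Q_{\mathbf u,\omega}^{\overline{\sigma\cup\{i\}}}$ such that $\mathbf x^{\mathbf u+\mathbf m_{\mathbf z}}-\mathbf x^{\mathbf u+\mathbf m_{\mathbf z}-B\mathbf z}\in (I_{\mathcal C_{\mathcal A}}:\mathbf x_{\sigma\cup\{i\}}^\infty)$.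
   Context: Setting: $\mathcal A=\{\mathbf a_1,\dots,\mathbf a_n\}\subset\mathbb{Z}^d$ is an ordered vector configuration such that the $d\times n$ matrix $A=[\mathbf a_1\cdots\mathbf a_n]$ has rank $d$; $\mathcal L_{\mathcal A}=\{\mathbf u\in\mathbb{Z}^n: A\mathbf u=\mathbf 0\}$, and it is assumed that $\mathcal L_{\mathcal A}\cap\mathbb{N}^n=\{\mathbf 0\}$ ($\mathbb N$ contains $0$). $\mathbf k$ is an algebraically closed field, $\mathbf k[\mathbf x]=\mathbf k[x_1,\dots,x_n]$, $[n]=\{1,\dots,n\}$. For $\mathbf u\in\mathbb{Z}^n$: $\mathrm{supp}(\mathbf u)=\{i:u_i\ne0\}$, $\mathbf u^+_i=\max(u_i,0)$, $\mathbf u^-_i=\max(-u_i,0)$. Circuit: a non-zero vector $\mathbf c\in\mathcal L_{\mathcal A}$ whose entries have greatest common divisor one and such that no non-zero $\mathbf d\in\mathcal L_{\mathcal A}$ has $\mathrm{supp}(\mathbf d)\subsetneq\mathrm{supp}(\mathbf c)$. Circuit ideal: $I_{\mathcal C_{\mathcal A}}=\langle\mathbf x^{\mathbf c^+}-\mathbf x^{\mathbf c^-}:\mathbf c\text{ a circuit}\rangle$. Toric ideal: $I_{\mathcal A}=\langle\mathbf x^{\mathbf u^+}-\mathbf x^{\mathbf u^-}:\mathbf u\in\mathcal L_{\mathcal A}\rangle$. Initial ideals: for $\omega\in\mathbb{R}^n$, $\mathrm{in}_\omega(f)$ is the sum of the terms $c\,\mathbf x^{\mathbf u}$ of $f$ with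 $\omega\cdot\mathbf u$ maximal, and $\mathrm{in}_\omega(I)=\langle\mathrm{in}_\omega(f):f\in I\rangle$. Regular triangulation $\Delta_\omega$: the simplicial complex on $[n]$ in which $\tau\subseteq[n]$ is a face iff there is $\mathbf c\in\mathbb{R}^d$ with $\mathbf a_j\cdot\mathbf c=\omega_j$ for $j\in\tau$ and $\mathbf a_j\cdot\mathbf c<\omega_j$ for $j\notin\tau$. Standard pairs: a standard monomial of a monomial ideal $M$ is a monomial not in $M$. For a standard monomial $\mathbf x^{\mathbf u}$ and $\sigma\subseteq[n]$, $(\mathbf x^{\mathbf u},\sigma)$ is an admissible pair of $M$ if $\mathrm{supp}(\mathbf u)\cap\sigma=\emptyset$ and all monomials in $\mathbf x^{\mathbf u}\cdot\mathbf k[x_j:j\in\sigma]$ are standard. It is a standard pair if there is no other admissible pair $(\mathbf x^{\mathbf v},\tau)$ with $\mathbf v\le\mathbf u$ and $\mathrm{supp}(\mathbf u-\mathbf v)\cup\sigma\subseteq\tau$. Polytopes: $B\in\mathbb{Z}^{n\times(n-d)}$ is a fixed matrix whose columns form a basis of the lattice $\mathcal L_{\mathcal A}$. For $\tau\subseteq[n]$ let $\bar\tau=[n]\setminus\tau$ and $\mathbf x_\tau=\prod_{i\in\tau}x_i$. For $\mathbf u\in\mathbb{N}^n$, $Q_{\mathbf u,\omega}^{\bar\tau}=\{\mathbf z\in\mathbb{R}^{n-d}: (B\mathbf z\le\mathbf u)^{\bar\tau},\ (-\omega B)\mathbf z\le0\}$, where $(B\mathbf z\le\mathbf u)^{\bar\tau}$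 is the subsystem of inequalities of $B\mathbf z\le\mathbf u$ indexed by $\bar\tau$. For a lattice point $\mathbf z$ put $\mathbf m_{\mathbf z}=(\mathbf u-B\mathbf z)^-$. Also $(I:g^\infty)=\{h: g^kh\in I\text{ for some }k\ge0\}$. *)

theory Defs
  imports "HOL-Analysis.Analysis" "HOL-Library.Poly_Mapping"
    "HOL-Computational_Algebra.Polynomial"
begin

section \<open>Polynomials and their ideals\<close>

text \<open>
  The finite index type \<open>'n\<close> plays the role of \<open>{1, ..., n}\<close>, and
  the polynomial ring \<open>k[x_1, ..., x_n]\<close> is the monoid algebra of the monoid of
  exponent vectors \<open>nat ^ 'n\<close>, with the convolution product of
  \<^theory>\<open>HOL-Library.Poly_Mapping\<close>.
\<close>

type_synonym ('n, 'k) mpoly = "(nat ^ 'n) \<Rightarrow>\<^sub>0 'k"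

definition monomial :: "nat ^ 'n::finite \<Rightarrow> ('n, 'k::comm_ring_1) mpoly" where
  "monomial u = Poly_Mapping.single u 1"

definition var :: "'n::finite \<Rightarrow> ('n, 'k::comm_ring_1) mpoly" where
  "var i = monomial (axis i 1)"

definition var_prod :: "'n::finite set \<Rightarrow> ('n, 'k::comm_ring_1) mpoly" where
  "var_prod \<tau> = (\<Prod>i\<in>\<tau>. var i)"

text \<open>A ring is a module over itself; its ideals are the submodules.\<close>

lemma module_times: "module ((*) :: 'a::comm_ring_1 \<Rightarrow> 'a \<Rightarrow> 'a)"
  by unfold_locales (simp_all add: algebra_simps)

definition ideal_gen :: "'a::comm_ring_1 set \<Rightarrow> 'a set" where
  "ideal_gen S = module.span (*) S"

definition saturation :: "'a::comm_ring_1 set \<Rightarrow> 'a \<Rightarrow> 'a set" where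
  "saturation I g = {h. \<exists>k::nat. g ^ k * h \<in> I}"

definition monomial_ideal :: "('n::finite, 'k::comm_ring_1) mpoly set \<Rightarrow> bool" where
  "monomial_ideal M \<longleftrightarrow> (\<exists>S. M = ideal_gen (monomial ` S))"


section \<open>Vectors\<close>

definition supp :: "('a::zero) ^ 'n \<Rightarrow> 'n set" where
  "supp u = {i. u $ i \<noteq> 0}"

definition pos_part :: "int ^ 'n::finite \<Rightarrow> nat ^ 'n" where
  "pos_part u = (\<chi> i. nat (max (u $ i) 0))"

definition neg_part :: "int ^ 'n::finite \<Rightarrow> nat ^ 'n" where
  "neg_part u = (\<chi> i. nat (max (- (u $ i)) 0))"

definition int_vec :: "nat ^ 'n::finite \<Rightarrow> int ^ 'n" where
  "int_vec u = (\<chi> i. int (u $ i))"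

definition real_vec :: "int ^ 'n::finite \<Rightarrow> real ^ 'n" where
  "real_vec u = (\<chi> i. real_of_int (u $ i))"


section \<open>Toric and circuit ideals\<close>

text \<open>The configuration is given by the matrix \<open>A\<close> having its vectors as columns.\<close>

definition relation_lattice :: "int ^ 'n::finite ^ 'd::finite \<Rightarrow> (int ^ 'n) set" where
  "relation_lattice A = {u. A *v u = 0}"

definition circuit :: "int ^ 'n::finite ^ 'd::finite \<Rightarrow> int ^ 'n \<Rightarrow> bool" where
  "circuit A c \<longleftrightarrow> c \<in> relation_lattice A \<and> c \<noteq> 0 \<and> Gcd (range (\<lambda>i. c $ i)) = 1 \<and>
     \<not> (\<exists>e\<in>relation_lattice A. e \<noteq> 0 \<and> supp e \<subset> supp c)"

definition lattice_binomial :: "int ^ 'n::finite \<Rightarrow> ('n, 'k::comm_ring_1) mpoly" where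
  "lattice_binomial u = monomial (pos_part u) - monomial (neg_part u)"

definition toric_ideal ::
    "int ^ 'n::finite ^ 'd::finite \<Rightarrow> ('n, 'k::comm_ring_1) mpoly set" where
  "toric_ideal A = ideal_gen (lattice_binomial ` relation_lattice A)"

definition circuit_ideal ::
    "int ^ 'n::finite ^ 'd::finite \<Rightarrow> ('n, 'k::comm_ring_1) mpoly set" where
  "circuit_ideal A = ideal_gen (lattice_binomial ` {c. circuit A c})"


section \<open>Initial ideals\<close>

definition weight :: "real ^ 'n::finite \<Rightarrow> nat ^ 'n \<Rightarrow> real" where
  "weight \<omega> u = \<omega> \<bullet> real_vec (int_vec u)"

definition initial_form ::
    "real ^ 'n::finite \<Rightarrow> ('n, 'k::comm_ring_1) mpoly \<Rightarrow> ('n, 'k) mpoly" where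
  "initial_form \<omega> f =
     (\<Sum>u\<in>{u \<in> Poly_Mapping.keys f. \<forall>v\<in>Poly_Mapping.keys f. weight \<omega> v \<le> weight \<omega> u}.
        Poly_Mapping.single u (Poly_Mapping.lookup f u))"

definition initial_ideal ::
    "real ^ 'n::finite \<Rightarrow> ('n, 'k::comm_ring_1) mpoly set \<Rightarrow> ('n, 'k) mpoly set" where
  "initial_ideal \<omega> I = ideal_gen (initial_form \<omega> ` I)"


section \<open>Regular triangulations\<close>

definition regular_triangulation ::
    "int ^ 'n::finite ^ 'd::finite \<Rightarrow> real ^ 'n \<Rightarrow> 'n set set" where
  "regular_triangulation A \<omega> =
     {\<tau>. \<exists>c :: real ^ 'd. (\<forall>j\<in>\<tau>. real_vec (column j A) \<bullet> c = \<omega> $ j) \<and>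
                         (\<forall>j\<in>-\<tau>. real_vec (column j A) \<bullet> c < \<omega> $ j)}"


section \<open>Standard pairs\<close>

definition standard_monomial ::
    "('n::finite, 'k::comm_ring_1) mpoly set \<Rightarrow> nat ^ 'n \<Rightarrow> bool" where
  "standard_monomial M u \<longleftrightarrow> monomial u \<notin> M"

text \<open>The monomials in \<open>x^u * k[x_j : j in \<sigma>]\<close> are the \<open>x^(u + w)\<close> with
  \<open>supp w \<subseteq> \<sigma>\<close>.\<close>

definition admissible_pair ::
    "('n::finite, 'k::comm_ring_1) mpoly set \<Rightarrow> nat ^ 'n \<Rightarrow> 'n set \<Rightarrow> bool" where
  "admissible_pair M u \<sigma> \<longleftrightarrow> standard_monomial M u \<and> supp u \<inter> \<sigma> = {} \<and>
     (\<forall>w. supp w \<subseteq> \<sigma> \<longrightarrow> standard_monomial M (u + w))"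

definition standard_pair ::
    "('n::finite, 'k::comm_ring_1) mpoly set \<Rightarrow> nat ^ 'n \<Rightarrow> 'n set \<Rightarrow> bool" where
  "standard_pair M u \<sigma> \<longleftrightarrow> admissible_pair M u \<sigma> \<and>
     \<not> (\<exists>v \<tau>. (v, \<tau>) \<noteq> (u, \<sigma>) \<and> admissible_pair M v \<tau> \<and>
            v \<le> u \<and> supp (u - v) \<union> \<sigma> \<subseteq> \<tau>)"


section \<open>The polytopes\<close>

text \<open>
  Here \<open>r\<close> stands for \<open>n - d\<close>, which may be \<open>0\<close> and so cannot be the
  cardinality of an index type. Vectors of length \<open>r\<close> are functions on \<^typ>\<open>nat\<close>
  vanishing outside \<open>{..<r}\<close> (as in \<open>Euclidean_space r\<close>), and a matrix with
  \<open>r\<close> columns is the sequence of its columns, of which only the first \<open>r\<close> are used.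
\<close>

definition coord_space :: "nat \<Rightarrow> (nat \<Rightarrow> 'a::zero) set" where
  "coord_space r = {z. \<forall>k\<ge>r. z k = 0}"

definition mat_app ::
    "nat \<Rightarrow> (nat \<Rightarrow> ('a::comm_ring_1) ^ 'n::finite) \<Rightarrow> (nat \<Rightarrow> 'a) \<Rightarrow> 'a ^ 'n" where
  "mat_app r B z = (\<Sum>k<r. z k *s B k)"

definition lattice_basis ::
    "(int ^ 'n::finite) set \<Rightarrow> nat \<Rightarrow> (nat \<Rightarrow> int ^ 'n) \<Rightarrow> bool" where
  "lattice_basis L r B \<longleftrightarrow> (\<forall>k<r. B k \<in> L) \<and>
     (\<forall>u\<in>L. \<exists>z\<in>coord_space r. u = mat_app r B z) \<and>
     (\<forall>z\<in>coord_space r. mat_app r B z = 0 \<longrightarrow> z = (\<lambda>_. 0))"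

text \<open>The set \<open>T\<close> indexes the inequalities of \<open>B z \<le> u\<close> that are kept.\<close>

definition Q_polytope ::
    "nat \<Rightarrow> (nat \<Rightarrow> int ^ 'n::finite) \<Rightarrow> nat ^ 'n \<Rightarrow> real ^ 'n \<Rightarrow> 'n set \<Rightarrow> (nat \<Rightarrow> real) set" where
  "Q_polytope r B u \<omega> T =
     {z \<in> coord_space r.
        (\<forall>i\<in>T. mat_app r (\<lambda>k. real_vec (B k)) z $ i \<le> real (u $ i)) \<and>
        (\<Sum>k<r. - (\<omega> \<bullet> real_vec (B k)) * z k) \<le> 0}"

definition nonzero_lattice_points :: "nat \<Rightarrow> (nat \<Rightarrow> real) set \<Rightarrow> (nat \<Rightarrow> int) set" where
  "nonzero_lattice_points r Q =
     {z \<in> coord_space r. z \<noteq> (\<lambda>_. 0) \<and> (\<lambda>k. real_of_int (z k)) \<in> Q}"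

text \<open>For \<open>b = B z\<close> and \<open>m = (u - b)^-\<close>, this is \<open>x^(u + m) - x^(u + m - b)\<close>.
  The vector \<open>u + m - b\<close> is the positive part of \<open>u - b\<close>, so its entries are
  nonnegative and the conversion to \<^typ>\<open>nat\<close> loses nothing.\<close>

definition shift_binomial ::
    "nat ^ 'n::finite \<Rightarrow> int ^ 'n \<Rightarrow> ('n, 'k::comm_ring_1) mpoly" where
  "shift_binomial u b =
     (let m = neg_part (int_vec u - b)
      in monomial (u + m) - monomial (\<chi> i. nat (int ((u + m) $ i) - b $ i)))"

end

theory Submission
  imports Defs
begin

text \<open>
  Let \<open>I\<close> be the circuit ideal and call exponent vectors \<open>v\<close>, \<open>w\<close> equivalent if
  \<open>x^v - x^w \<in> I\<close>. As \<open>I\<close> is generated by differences of monomials, a polynomial in \<open>I\<close> has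
  coefficient sum \<open>0\<close> over every equivalence class. Two consequences carry the proof.

  First, the standard monomials of the initial ideal are the exponents that are the
  unique point of least weight in their class (\<open>standard_monomial_binomial_ideal\<close>). If
  \<open>w\<close> is equivalent to \<open>v\<close> and not heavier, then \<open>x^v\<close> occurs in the initial form of
  \<open>x^v - x^w\<close>, and the initial ideal, being monomial, contains it. Conversely, the sum of
  the coefficients over the points of least weight in a class vanishes on the initial
  ideal, but not on \<open>x^v\<close> when \<open>v\<close> is such a point.

  Second, equivalent exponents differ by a vector of the relation lattice, that is by
  \<open>B z\<close> for a lattice point \<open>z\<close> (\<open>circuit_ideal_binomial_lattice\<close>). Hence a reason for some
  \<open>x^(u + w)\<close> with \<open>supp w \<subseteq> \<tau>\<close> not to be standard is an equivalent exponent
  \<open>u + w - B z\<close> that is not heavier, with \<open>z \<noteq> 0\<close>. That it is nonnegative off \<open>\<tau>\<close> and not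
  heavier says that \<open>z\<close> lies in the polytope for the complement of \<open>\<tau>\<close>; and since \<open>w\<close> may
  be any vector supported in \<open>\<tau>\<close>, the equivalence says that the binomial of \<open>z\<close> lies in
  the saturation of \<open>I\<close> by the variables of \<open>\<tau>\<close> (\<open>standard_translates_iff\<close>).

  For \<open>\<tau> = \<sigma>\<close> this turns condition (1) into admissibility of \<open>(x^u, \<sigma>)\<close>. For
  \<open>\<tau> = \<sigma> \<union> {i}\<close> it turns condition (2) into the statement that no further variable can be
  added to \<open>\<sigma>\<close>, which is what the maximality in the definition of a standard pair amounts
  to (\<open>standard_pair_iff_maximal\<close>).
\<close>

section \<open>Ideals and monomials\<close>

interpretation ring_module: module "(*) :: 'a::comm_ring_1 \<Rightarrow> 'a \<Rightarrow> 'a"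
  by (rule module_times)

lemma ideal_gen_closed:
  assumes "I = ideal_gen S"
  shows "0 \<in> I" "f \<in> I \<Longrightarrow> g \<in> I \<Longrightarrow> f + g \<in> I" "f \<in> I \<Longrightarrow> g \<in> I \<Longrightarrow> f - g \<in> I"
    "f \<in> I \<Longrightarrow> h * f \<in> I" "s \<in> S \<Longrightarrow> s \<in> I"
  unfolding assms ideal_gen_def
  by (simp_all add: ring_module.span_zero ring_module.span_add ring_module.span_diff
      ring_module.span_scale ring_module.span_base)

lemma sum_single_lookup:
  "(\<Sum>v\<in>Poly_Mapping.keys f. Poly_Mapping.single v (Poly_Mapping.lookup f v)) = f"
proof (rule poly_mapping_eqI)
  fix k
  show "Poly_Mapping.lookup (\<Sum>v\<in>Poly_Mapping.keys f.
      Poly_Mapping.single v (Poly_Mapping.lookup f v)) k = Poly_Mapping.lookup f k"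
    by (simp add: lookup_sum lookup_single when_def in_keys_iff)
qed

text \<open>
  Expanding a coefficient polynomial into its terms shows that an ideal consists of the
  sums of term multiples of its generators; so additive maps that are not linear over the
  polynomial ring, such as sums of coefficients, can be studied on these multiples.
\<close>

lemma ideal_gen_induct [consumes 1, case_names zero add single]:
  fixes f :: "('n::finite, 'k::comm_ring_1) mpoly"
  assumes "f \<in> ideal_gen S"
    and "P 0"
    and add: "\<And>f g. P f \<Longrightarrow> P g \<Longrightarrow> P (f + g)"
    and single: "\<And>w c g. g \<in> S \<Longrightarrow> P (Poly_Mapping.single w c * g)"
  shows "P f"
  using assms(1) unfolding ideal_gen_def
proof (induction rule: ring_module.span_induct_alt)
  case base
  show ?case by fact
next
  case (step a g h)
  have *: "P (\<Sum>v\<in>V. Poly_Mapping.single v (Poly_Mapping.lookup a v) * g)" for V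
    by (induction V rule: infinite_finite_induct) (simp_all add: assms(2) add single step)
  have "P (a * g)"
    using *[of "Poly_Mapping.keys a"] unfolding sum_distrib_right[symmetric] sum_single_lookup .
  then show ?case using step by (simp add: add)
qed

lemma monomial_add: "monomial (u + v) = monomial u * monomial v"
  by (simp add: monomial_def mult_single)

lemma monomial_power: "(monomial u :: ('n::finite, 'k::comm_ring_1) mpoly) ^ k = monomial (\<chi> i. k * u $ i)"
proof (induction k)
  case 0
  have "(\<chi> i. (0 :: nat)) = (0 :: nat ^ 'n)" by (simp add: vec_eq_iff)
  then show ?case by (simp add: monomial_def)
next
  case (Suc k)
  have "(\<chi> i. Suc k * u $ i) = u + (\<chi> i. k * u $ i)" by (simp add: vec_eq_iff)
  then show ?case using Suc by (simp add: monomial_add)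
qed

lemma var_prod_eq_monomial:
  "var_prod (\<tau> :: 'n::finite set) = monomial (\<chi> i. if i \<in> \<tau> then 1 else 0)"
proof (induction \<tau> rule: infinite_finite_induct)
  case (infinite A)
  then show ?case by simp
next
  case empty
  have "(\<chi> i. (0 :: nat)) = (0 :: nat ^ 'n)" by (simp add: vec_eq_iff)
  then show ?case by (simp add: var_prod_def monomial_def)
next
  case (insert x F)
  have "(\<chi> i. if i \<in> insert x F then 1 else (0 :: nat)) = axis x 1 + (\<chi> i. if i \<in> F then 1 else 0)"
    using insert by (auto simp: vec_eq_iff axis_def)
  then show ?case using insert by (simp add: var_prod_def var_def monomial_add)
qed

lemma monomial_ideal_contains_monomials:
  fixes f :: "('n::finite, 'k::comm_ring_1) mpoly"
  assumes "monomial_ideal M" "f \<in> M" "v \<in> Poly_Mapping.keys f"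
  shows "monomial v \<in> M"
proof -
  obtain S where S: "M = ideal_gen (monomial ` S)"
    using assms(1) unfolding monomial_ideal_def by blast
  note M = ideal_gen_closed[OF S]
  have "f \<in> ideal_gen (monomial ` S)" using assms(2) S by simp
  then have "\<forall>v\<in>Poly_Mapping.keys f. monomial v \<in> M"
  proof (induction rule: ideal_gen_induct)
    case zero
    show ?case by simp
  next
    case (add f g)
    then show ?case using keys_add[of f g] by blast
  next
    case (single w c g)
    then obtain s where s: "s \<in> S" "g = monomial s" by blast
    then have "monomial (w + s) \<in> M" using M(4)[OF M(5)] by (simp add: monomial_add)
    then show ?case using s by (auto simp: monomial_def mult_single split: if_splits)
  qed
  with assms(3) show ?thesis by blast
qed

section \<open>Sums of coefficients over sets of exponents\<close>

text \<open>
  The binomials in a binomial ideal are detected by these functionals: if \<open>coeff_sum C\<close>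
  vanishes on the ideal, then \<open>C\<close> contains both exponents of such a binomial or neither.
\<close>

definition coeff_sum :: "'a set \<Rightarrow> ('a \<Rightarrow>\<^sub>0 'k::comm_ring_1) \<Rightarrow> 'k" where
  "coeff_sum C f = (\<Sum>v\<in>Poly_Mapping.keys f \<inter> C. Poly_Mapping.lookup f v)"

lemma coeff_sum_superset:
  assumes "finite V" "Poly_Mapping.keys f \<subseteq> V"
  shows "coeff_sum C f = (\<Sum>v\<in>V \<inter> C. Poly_Mapping.lookup f v)"
  unfolding coeff_sum_def
  by (rule sum.mono_neutral_left) (use assms in \<open>auto simp: in_keys_iff\<close>)

lemma coeff_sum_0 [simp]: "coeff_sum C 0 = 0"
  by (simp add: coeff_sum_def)

lemma coeff_sum_add: "coeff_sum C (f + g) = coeff_sum C f + coeff_sum C g"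
proof -
  let ?V = "Poly_Mapping.keys f \<union> Poly_Mapping.keys g"
  have "coeff_sum C h = (\<Sum>v\<in>?V \<inter> C. Poly_Mapping.lookup h v)" if "h \<in> {f, g, f + g}" for h
    using that by (intro coeff_sum_superset) (use keys_add[of f g] in auto)
  then show ?thesis by (simp add: lookup_add sum.distrib)
qed

lemma coeff_sum_diff: "coeff_sum C (f - g) = coeff_sum C f - coeff_sum C g"
  using coeff_sum_add[of C "f - g" g] by simp

lemma coeff_sum_single: "coeff_sum C (Poly_Mapping.single v c) = (if v \<in> C then c else 0)"
  by (simp add: coeff_sum_def)

lemma coeff_sum_sum: "coeff_sum C (\<Sum>x\<in>X. f x) = (\<Sum>x\<in>X. coeff_sum C (f x))"
  by (induction X rule: infinite_finite_induct) (simp_all add: coeff_sum_add)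

lemma coeff_sum_single_mult:
  "coeff_sum C (Poly_Mapping.single w c * f) = c * coeff_sum {v. w + v \<in> C} f"
proof -
  have "coeff_sum C (Poly_Mapping.single w c * f) =
      coeff_sum C (\<Sum>v\<in>Poly_Mapping.keys f. Poly_Mapping.single (w + v) (c * Poly_Mapping.lookup f v))"
    by (subst (1) sum_single_lookup[of f, symmetric])
      (simp add: sum_distrib_left mult_single)
  also have "\<dots> = (\<Sum>v\<in>Poly_Mapping.keys f. if w + v \<in> C then c * Poly_Mapping.lookup f v else 0)"
    by (simp add: coeff_sum_sum coeff_sum_single)
  also have "\<dots> = c * coeff_sum {v. w + v \<in> C} f"
    by (simp add: coeff_sum_def sum_distrib_left sum.inter_filter[symmetric] Int_def)
  finally show ?thesis .
qed

text \<open>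
  The hypothesis on \<open>C\<close> says that multiplying a generator by a monomial leaves both of its
  terms inside \<open>C\<close> or both outside, so that their coefficients cancel.
\<close>

lemma coeff_sum_binomial_ideal:
  fixes f :: "('n::finite, 'k::comm_ring_1) mpoly"
  assumes "f \<in> ideal_gen ((\<lambda>(p, q). monomial p - monomial q) ` E)"
    and C: "\<And>p q w. (p, q) \<in> E \<Longrightarrow> w + p \<in> C \<longleftrightarrow> w + q \<in> C"
  shows "coeff_sum C f = 0"
  using assms(1)
proof (induction rule: ideal_gen_induct)
  case zero
  show ?case by simp
next
  case (add f g)
  then show ?case by (simp add: coeff_sum_add)
next
  case (single w c g)
  then obtain p q where "(p, q) \<in> E" "g = monomial p - monomial q" by auto
  then show ?case using C[of p q w]
    by (simp add: coeff_sum_single_mult coeff_sum_diff monomial_def coeff_sum_single)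
qed

section \<open>Standard monomials of the initial ideal of a binomial ideal\<close>

lemma weight_add: "weight \<omega> (u + v) = weight \<omega> u + weight \<omega> v"
proof -
  have "real_vec (int_vec (u + v)) = real_vec (int_vec u) + real_vec (int_vec v)"
    by (simp add: real_vec_def int_vec_def vec_eq_iff)
  then show ?thesis by (simp add: weight_def inner_add_right)
qed

lemma lookup_initial_form:
  "Poly_Mapping.lookup (initial_form \<omega> f) v =
    (if \<forall>w\<in>Poly_Mapping.keys f. weight \<omega> w \<le> weight \<omega> v then Poly_Mapping.lookup f v else 0)"
  unfolding initial_form_def
  by (auto simp: lookup_sum lookup_single when_def in_keys_iff)

lemma keys_initial_form: "Poly_Mapping.keys (initial_form \<omega> f) \<subseteq> Poly_Mapping.keys f"
  by (auto simp: in_keys_iff lookup_initial_form split: if_splits)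

text \<open>
  Either \<open>f\<close> has a term heavier than \<open>m\<close>, and then its initial form has no term of weight
  \<open>m\<close>; or the terms of \<open>f\<close> in \<open>C\<close> all have weight exactly \<open>m\<close>, and then all of them survive
  in the initial form.
\<close>

lemma coeff_sum_initial_form:
  assumes "coeff_sum C f = 0" and m: "\<And>v. v \<in> C \<Longrightarrow> m \<le> weight \<omega> v"
  shows "coeff_sum {v \<in> C. weight \<omega> v = m} (initial_form \<omega> f) = 0"
proof -
  let ?D = "{v \<in> C. weight \<omega> v = m}"
  have eq: "coeff_sum ?D (initial_form \<omega> f) =
      (\<Sum>v\<in>Poly_Mapping.keys f \<inter> ?D. Poly_Mapping.lookup (initial_form \<omega> f) v)"
    by (rule coeff_sum_superset) (simp_all add: keys_initial_form)
  show ?thesis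
  proof (cases "\<forall>w\<in>Poly_Mapping.keys f. weight \<omega> w \<le> m")
    case True
    then have keys: "Poly_Mapping.keys f \<inter> ?D = Poly_Mapping.keys f \<inter> C"
      using m by (auto intro: antisym)
    from True have look: "Poly_Mapping.lookup (initial_form \<omega> f) v = Poly_Mapping.lookup f v"
      if "v \<in> ?D" for v using that by (simp add: lookup_initial_form)
    have "coeff_sum ?D (initial_form \<omega> f) =
        (\<Sum>v\<in>Poly_Mapping.keys f \<inter> ?D. Poly_Mapping.lookup f v)"
      unfolding eq by (rule sum.cong[OF refl]) (rule look, blast)
    also have "\<dots> = coeff_sum C f" unfolding keys coeff_sum_def ..
    also have "\<dots> = 0" by fact
    finally show ?thesis .
  next
    case False
    then show ?thesis unfolding eq by (intro sum.neutral) (auto simp: lookup_initial_form)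
  qed
qed

text \<open>
  The criterion reduces membership in the initial ideal to a comparison of weights inside
  one equivalence class modulo \<open>I\<close>. The strict inequality is where genericity enters: two
  different points of least weight would put their difference, which is its own initial
  form, into the initial ideal, and that ideal, being monomial, would contain both of them.
\<close>

lemma standard_monomial_binomial_ideal:
  fixes I :: "('n::finite, 'k::comm_ring_1) mpoly set"
  assumes I: "I = ideal_gen ((\<lambda>(p, q). monomial p - monomial q) ` E)"
    and mono: "monomial_ideal (initial_ideal \<omega> I)"
  shows "standard_monomial (initial_ideal \<omega> I) v \<longleftrightarrow>
    (\<forall>w. w \<noteq> v \<longrightarrow> monomial v - monomial w \<in> I \<longrightarrow> weight \<omega> v < weight \<omega> w)"
proof
  note IC = ideal_gen_closed[OF I]
  let ?M = "initial_ideal \<omega> I"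
  note MC = ideal_gen_closed[OF initial_ideal_def[of \<omega> I]]
  {
    assume std: "standard_monomial ?M v"
    show "\<forall>w. w \<noteq> v \<longrightarrow> monomial v - monomial w \<in> I \<longrightarrow> weight \<omega> v < weight \<omega> w"
    proof (intro allI impI, rule ccontr)
      fix w
      assume w: "w \<noteq> v" "monomial v - monomial w \<in> I" "\<not> weight \<omega> v < weight \<omega> w"
      let ?f = "monomial v - monomial w :: ('n, 'k) mpoly"
      have look: "Poly_Mapping.lookup ?f x = (if x = v then 1 else if x = w then - 1 else 0)" for x
        using w(1) by (simp add: monomial_def lookup_minus lookup_single when_def)
      have "Poly_Mapping.lookup (initial_form \<omega> ?f) v = 1"
        using w(3) by (auto simp: lookup_initial_form look in_keys_iff split: if_splits)
      then have "v \<in> Poly_Mapping.keys (initial_form \<omega> ?f)" by (simp add: in_keys_iff)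
      with monomial_ideal_contains_monomials[OF mono MC(5)] w(2) have "monomial v \<in> ?M" by blast
      with std show False by (simp add: standard_monomial_def)
    qed
  next
    assume min: "\<forall>w. w \<noteq> v \<longrightarrow> monomial v - monomial w \<in> I \<longrightarrow> weight \<omega> v < weight \<omega> w"
    \<comment> \<open>\<open>C\<close> is the class of \<open>v\<close> and \<open>D\<close> its part of least weight; \<open>coeff_sum D\<close> will
      vanish on the initial ideal but not on \<open>monomial v\<close>.\<close>
    define C where "C = {w. monomial v - monomial w \<in> I}"
    define D where "D = {w \<in> C. weight \<omega> w = weight \<omega> v}"
    have vC: "v \<in> C" using IC(1) by (simp add: C_def)
    have minC: "weight \<omega> v \<le> weight \<omega> w" if "w \<in> C" for w
      using that min by (cases "w = v") (auto simp: C_def less_imp_le)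
    have closed: "w + p \<in> C \<longleftrightarrow> w + q \<in> C" if "(p, q) \<in> E" for p q w
    proof -
      have "monomial p - monomial q \<in> I" using that by (intro IC(5)) force
      then have "monomial (w + p) - monomial (w + q) \<in> I"
        using IC(4)[of "monomial p - monomial q" "monomial w"] by (simp add: monomial_add right_diff_distrib)
      then show ?thesis
        using IC(2)[of "monomial v - monomial (w + p)" "monomial (w + p) - monomial (w + q)"]
          IC(3)[of "monomial v - monomial (w + q)" "monomial (w + p) - monomial (w + q)"]
        by (auto simp: C_def)
    qed
    have "coeff_sum D g = 0" if "g \<in> ideal_gen (initial_form \<omega> ` I)" for g
      using that
    proof (induction rule: ideal_gen_induct)
      case zero
      show ?case by simp
    next
      case (add f g)
      then show ?case by (simp add: coeff_sum_add)
    next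
      case (single w c g)
      then obtain f where f: "f \<in> I" "g = initial_form \<omega> f" by blast
      \<comment> \<open>Instead of multiplying \<open>f\<close> by the term, translate \<open>C\<close> and \<open>D\<close> back by \<open>w\<close>.\<close>
      let ?C = "{x. w + x \<in> C}"
      have "coeff_sum ?C f = 0"
        using f(1) unfolding I
        by (rule coeff_sum_binomial_ideal) (use closed in \<open>simp add: add.assoc[symmetric]\<close>)
      then have "coeff_sum {x \<in> ?C. weight \<omega> x = weight \<omega> v - weight \<omega> w} (initial_form \<omega> f) = 0"
        by (rule coeff_sum_initial_form) (use minC in \<open>force simp: weight_add\<close>)
      moreover have "{x \<in> ?C. weight \<omega> x = weight \<omega> v - weight \<omega> w} = {x. w + x \<in> D}"
        by (auto simp: D_def weight_add)
      ultimately show ?case using f(2) by (simp add: coeff_sum_single_mult)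
    qed
    moreover have "coeff_sum D (monomial v) = (1 :: 'k)"
      using vC by (simp add: monomial_def coeff_sum_single D_def)
    ultimately show "standard_monomial ?M v"
      unfolding standard_monomial_def initial_ideal_def by force
  }
qed

lemma standard_monomial_divisor:
  assumes "standard_monomial (initial_ideal \<omega> I) (v + w)"
  shows "standard_monomial (initial_ideal \<omega> I) v"
  using assms ideal_gen_closed(4)[OF initial_ideal_def[of \<omega> I], of "monomial v" "monomial w"]
  by (auto simp: standard_monomial_def monomial_add mult.commute)

section \<open>Monomial translates and lattice points\<close>

text \<open>
  Every monomial in the variables of \<open>\<tau>\<close> divides a power of their product, so a power of
  the product may be replaced by an arbitrary such monomial.
\<close>

lemma saturation_var_prod_iff:
  fixes I :: "('n::finite, 'k::comm_ring_1) mpoly set"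
  assumes I: "I = ideal_gen S"
  shows "monomial p - monomial q \<in> saturation I (var_prod \<tau>) \<longleftrightarrow>
    (\<exists>w. supp w \<subseteq> \<tau> \<and> monomial (p + w) - monomial (q + w) \<in> I)"
proof
  note IC = ideal_gen_closed[OF I]
  let ?e = "\<lambda>k. (\<chi> i. if i \<in> \<tau> then k else 0) :: nat ^ 'n"
  have "(\<chi> i. k * (?e 1 $ i)) = ?e k" for k by (simp add: vec_eq_iff)
  then have e_power: "(var_prod \<tau> :: ('n, 'k) mpoly) ^ k = monomial (?e k)" for k
    unfolding var_prod_eq_monomial monomial_power by (rule arg_cong)
  have pow: "var_prod \<tau> ^ k * (monomial p - monomial q :: ('n, 'k) mpoly) =
      monomial (p + ?e k) - monomial (q + ?e k)" for k
    unfolding e_power monomial_add right_diff_distrib by (simp only: mult.commute)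
  {
    assume "monomial p - monomial q \<in> saturation I (var_prod \<tau>)"
    then obtain k where "monomial (p + ?e k) - monomial (q + ?e k) \<in> I"
      by (auto simp: saturation_def pow)
    moreover have "supp (?e k) \<subseteq> \<tau>" by (auto simp: supp_def split: if_splits)
    ultimately show "\<exists>w. supp w \<subseteq> \<tau> \<and> monomial (p + w) - monomial (q + w) \<in> I" by blast
  next
    assume "\<exists>w. supp w \<subseteq> \<tau> \<and> monomial (p + w) - monomial (q + w) \<in> I"
    then obtain w where w: "supp w \<subseteq> \<tau>" "monomial (p + w) - monomial (q + w) \<in> I" by blast
    define k where "k = Max (range (\<lambda>i. w $ i))"
    have "w $ i \<le> k" for i unfolding k_def by (intro Max_ge) auto
    then have "?e k $ i = w $ i + (?e k - w) $ i" for i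
      using w(1) by (cases "i \<in> \<tau>") (auto simp: supp_def)
    then obtain x where x: "?e k = w + x" unfolding vec_eq_iff vector_add_component by blast
    have "monomial (p + ?e k) - monomial (q + ?e k) =
        monomial x * (monomial (p + w) - monomial (q + w) :: ('n, 'k) mpoly)"
      unfolding x monomial_add right_diff_distrib by (simp only: ac_simps)
    with IC(4)[OF w(2), of "monomial x"] pow[of k]
    have "var_prod \<tau> ^ k * (monomial p - monomial q) \<in> I" by (simp only:)
    then show "monomial p - monomial q \<in> saturation I (var_prod \<tau>)"
      unfolding saturation_def by blast
  }
qed

lemma mat_app_real_vec:
  "mat_app r (\<lambda>k. real_vec (B k)) (\<lambda>k. real_of_int (z k)) = real_vec (mat_app r B z)"
  by (simp add: mat_app_def real_vec_def vec_eq_iff)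

lemma nonzero_lattice_points_Q_polytope:
  "z \<in> nonzero_lattice_points r (Q_polytope r B u \<omega> T) \<longleftrightarrow>
    z \<in> coord_space r \<and> z \<noteq> (\<lambda>_. 0) \<and> (\<forall>i\<in>T. mat_app r B z $ i \<le> int (u $ i)) \<and>
    0 \<le> \<omega> \<bullet> real_vec (mat_app r B z)"
proof -
  have sum: "real_vec (mat_app r B z) = (\<Sum>k<r. real_of_int (z k) *\<^sub>R real_vec (B k))"
    by (simp add: mat_app_def real_vec_def vec_eq_iff)
  have obj: "(\<Sum>k<r. - (\<omega> \<bullet> real_vec (B k)) * real_of_int (z k)) = - (\<omega> \<bullet> real_vec (mat_app r B z))"
    by (simp add: sum inner_sum_right sum_negf mult.commute)
  have row: "real_vec (mat_app r B z) $ i \<le> real (u $ i) \<longleftrightarrow> mat_app r B z $ i \<le> int (u $ i)" for i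
  proof -
    have "real (u $ i) = real_of_int (int (u $ i))" by simp
    then show ?thesis by (simp only: real_vec_def vec_lambda_beta of_int_le_iff)
  qed
  have coord: "(\<lambda>k. real_of_int (z k)) \<in> coord_space r \<longleftrightarrow> z \<in> coord_space r"
    by (simp add: coord_space_def)
  show ?thesis
    unfolding nonzero_lattice_points_def Q_polytope_def mem_Collect_eq mat_app_real_vec obj row coord
      neg_le_0_iff_le
    by blast
qed

lemma weight_eq_add_inner:
  assumes "int_vec p = int_vec q + b"
  shows "weight \<omega> p = weight \<omega> q + \<omega> \<bullet> real_vec b"
proof -
  have "real_vec (int_vec p) = real_vec (int_vec q) + real_vec b"
    using assms by (simp add: real_vec_def vec_eq_iff)
  then show ?thesis by (simp add: weight_def inner_add_right)
qed

text \<open>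
  The two exponents \<open>u + m\<close> and \<open>u + m - b\<close>, where \<open>m\<close> is the negative part of \<open>u - b\<close>, are
  the least translates of \<open>u\<close> and \<open>u - b\<close> by a common nonnegative vector that makes both
  nonnegative.
\<close>

lemma shift_binomial_eq:
  "shift_binomial u b =
    monomial (u + neg_part (int_vec u - b)) - monomial (pos_part (int_vec u - b))"
proof -
  have "(\<chi> i. nat (int ((u + neg_part (int_vec u - b)) $ i) - b $ i)) = pos_part (int_vec u - b)"
    by (auto simp: vec_eq_iff neg_part_def pos_part_def int_vec_def)
  then show ?thesis by (simp add: shift_binomial_def Let_def)
qed

text \<open>
  A lattice point \<open>z\<close> in the polytope with \<open>b = B z\<close> and a nonstandard exponent \<open>u + w\<close>
  correspond to each other: the binomial of \<open>z\<close> can be multiplied up to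
  \<open>x^(u + w) - x^(u + w - b)\<close> by a monomial in the variables of \<open>\<tau>\<close>, because the negative
  part \<open>m\<close> of \<open>u - b\<close> is supported in \<open>\<tau>\<close> and satisfies \<open>m \<le> w\<close> whenever \<open>u + w - b\<close> is
  nonnegative. The supports of \<open>u\<close> and \<open>\<tau>\<close> may meet, as they do when an index in the support
  of \<open>u\<close> is added to \<open>\<sigma>\<close>.
\<close>

lemma standard_translates_iff:
  fixes I :: "('n::finite, 'k::comm_ring_1) mpoly set"
  assumes I: "I = ideal_gen ((\<lambda>(p, q). monomial p - monomial q) ` E)"
    and mono: "monomial_ideal (initial_ideal \<omega> I)"
    and L: "\<And>p q. monomial p - monomial q \<in> I \<Longrightarrow> int_vec p - int_vec q \<in> L"
    and B: "lattice_basis L r B"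
  shows "(\<forall>w. supp w \<subseteq> \<tau> \<longrightarrow> standard_monomial (initial_ideal \<omega> I) (u + w)) \<longleftrightarrow>
    (\<forall>z\<in>nonzero_lattice_points r (Q_polytope r B u \<omega> (- \<tau>)).
      shift_binomial u (mat_app r B z) \<notin> saturation I (var_prod \<tau>))"
    (is "?std \<longleftrightarrow> ?Q")
proof
  note std_iff = standard_monomial_binomial_ideal[OF I mono]
  note sat_iff = saturation_var_prod_iff[OF I]
  have parts: "int_vec (u + neg_part (int_vec u - b)) = int_vec (pos_part (int_vec u - b)) + b" for b
    by (auto simp: vec_eq_iff int_vec_def pos_part_def neg_part_def)
  {
    assume ?std
    show ?Q
    proof (intro ballI notI)
      fix z
      define b where "b = mat_app r B z"
      define m p where "m = neg_part (int_vec u - b)" and "p = pos_part (int_vec u - b)"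
      assume "z \<in> nonzero_lattice_points r (Q_polytope r B u \<omega> (- \<tau>))"
      then have z: "z \<in> coord_space r" "z \<noteq> (\<lambda>_. 0)"
        and le: "\<And>i. i \<notin> \<tau> \<Longrightarrow> b $ i \<le> int (u $ i)" and wt: "0 \<le> \<omega> \<bullet> real_vec b"
        unfolding nonzero_lattice_points_Q_polytope b_def by auto
      assume "shift_binomial u (mat_app r B z) \<in> saturation I (var_prod \<tau>)"
      then obtain w where w: "supp w \<subseteq> \<tau>" "monomial (u + m + w) - monomial (p + w) \<in> I"
        by (auto simp: shift_binomial_eq sat_iff b_def m_def p_def)
      have "b \<noteq> 0" using B z by (auto simp: lattice_basis_def b_def)
      have eq: "int_vec (u + m + w) = int_vec (p + w) + b"
        using parts[of b] unfolding m_def p_def by (simp add: vec_eq_iff int_vec_def)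
      with \<open>b \<noteq> 0\<close> have ne: "p + w \<noteq> u + m + w" by auto
      have "supp m \<subseteq> \<tau>"
        using le by (force simp: m_def supp_def neg_part_def int_vec_def)
      with w(1) have "supp (m + w) \<subseteq> \<tau>" by (auto simp: supp_def)
      with \<open>?std\<close> have "standard_monomial (initial_ideal \<omega> I) (u + m + w)"
        by (simp add: add.assoc)
      with ne w(2) have "weight \<omega> (u + m + w) < weight \<omega> (p + w)" by (simp add: std_iff)
      with weight_eq_add_inner[OF eq, of \<omega>] wt show False by simp
    qed
  next
    assume ?Q
    show ?std
      unfolding std_iff
    proof (intro allI impI, rule ccontr)
      fix w x
      assume w: "supp w \<subseteq> \<tau>" and x: "x \<noteq> u + w" "monomial (u + w) - monomial x \<in> I"
        "\<not> weight \<omega> (u + w) < weight \<omega> x"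
      from L[OF x(2)] B obtain z where z: "z \<in> coord_space r"
        "int_vec (u + w) - int_vec x = mat_app r B z"
        unfolding lattice_basis_def by blast
      define b where "b = mat_app r B z"
      have eq: "int_vec (u + w) = int_vec x + b"
        using z(2) by (simp add: b_def algebra_simps)
      then have eqi: "int (u $ i) + int (w $ i) = int (x $ i) + b $ i" for i
        by (simp add: vec_eq_iff int_vec_def)
      have "b \<noteq> 0"
      proof
        assume "b = 0"
        then have "x $ i = u $ i + w $ i" for i using eqi[of i] by simp
        then have "x = u + w" by (simp add: vec_eq_iff)
        with x(1) show False ..
      qed
      then have "z \<noteq> (\<lambda>_. 0)" by (auto simp: b_def mat_app_def)
      moreover have "b $ i \<le> int (u $ i)" if "i \<notin> \<tau>" for i
      proof -
        have "w $ i = 0" using w that by (auto simp: supp_def)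
        with eqi[of i] show ?thesis by simp
      qed
      moreover have "0 \<le> \<omega> \<bullet> real_vec b"
        using weight_eq_add_inner[OF eq, of \<omega>] x(3) by simp
      ultimately have "z \<in> nonzero_lattice_points r (Q_polytope r B u \<omega> (- \<tau>))"
        using z(1) unfolding nonzero_lattice_points_Q_polytope b_def by auto
      with \<open>?Q\<close> have notin: "shift_binomial u b \<notin> saturation I (var_prod \<tau>)"
        by (simp add: b_def)
      define m p where "m = neg_part (int_vec u - b)" and "p = pos_part (int_vec u - b)"
      have mw: "m $ i \<le> w $ i" for i
        using eqi[of i] by (simp add: m_def neg_part_def int_vec_def)
      have uw: "u + w = u + m + (w - m)"
        using mw by (simp add: vec_eq_iff)
      have xp: "x = p + (w - m)"
      proof -
        have "x $ i = p $ i + (w $ i - m $ i)" for i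
          using eqi[of i] mw[of i] by (auto simp: m_def p_def neg_part_def pos_part_def int_vec_def)
        then show ?thesis by (simp add: vec_eq_iff)
      qed
      have "monomial (u + m + (w - m)) - monomial (p + (w - m)) \<in> I"
        using x(2) by (simp only: uw[symmetric] xp[symmetric])
      moreover have "supp (w - m) \<subseteq> \<tau>" using w by (auto simp: supp_def)
      ultimately have "shift_binomial u b \<in> saturation I (var_prod \<tau>)"
        unfolding shift_binomial_eq sat_iff m_def p_def by blast
      with notin show False ..
    qed
  }
qed

section \<open>Standard pairs\<close>

text \<open>
  A larger admissible pair \<open>(v, \<tau>)\<close> must have \<open>\<tau> \<noteq> \<sigma>\<close>, since \<open>u - v\<close> is supported in \<open>\<tau>\<close> and
  \<open>u\<close> vanishes on \<open>\<sigma>\<close>; for any \<open>i \<in> \<tau> - \<sigma>\<close> its monomials include all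
  \<open>x^(u + w)\<close> with \<open>supp w \<subseteq> \<sigma> \<union> {i}\<close>. Conversely, if these are standard, then setting the
  entry \<open>i\<close> of \<open>u\<close> to \<open>0\<close> gives an admissible pair with \<open>\<tau> = \<sigma> \<union> {i}\<close>, because divisors of
  standard monomials are standard.
\<close>

lemma standard_pair_iff_maximal:
  fixes I M :: "('n::finite, 'k::comm_ring_1) mpoly set" and \<omega> :: "real ^ 'n"
  assumes "supp u \<inter> \<sigma> = {}"
  defines "M \<equiv> initial_ideal \<omega> I"
  shows "standard_pair M u \<sigma> \<longleftrightarrow>
    (\<forall>w. supp w \<subseteq> \<sigma> \<longrightarrow> standard_monomial M (u + w)) \<and>
    (\<forall>i\<in>- \<sigma>. \<not> (\<forall>w. supp w \<subseteq> \<sigma> \<union> {i} \<longrightarrow> standard_monomial M (u + w)))"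
    (is "_ \<longleftrightarrow> ?std \<sigma> \<and> _")
proof -
  have "standard_monomial M u" if "?std \<sigma>" using that[rule_format, of 0] by (simp add: supp_def)
  then have adm: "admissible_pair M u \<sigma> \<longleftrightarrow> ?std \<sigma>"
    using assms(1) unfolding admissible_pair_def by blast
  have ex: "(\<exists>v \<tau>. (v, \<tau>) \<noteq> (u, \<sigma>) \<and> admissible_pair M v \<tau> \<and> v \<le> u \<and> supp (u - v) \<union> \<sigma> \<subseteq> \<tau>) \<longleftrightarrow>
      (\<exists>i\<in>- \<sigma>. ?std (\<sigma> \<union> {i}))"
  proof
    assume "\<exists>v \<tau>. (v, \<tau>) \<noteq> (u, \<sigma>) \<and> admissible_pair M v \<tau> \<and> v \<le> u \<and> supp (u - v) \<union> \<sigma> \<subseteq> \<tau>"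
    then obtain v \<tau> where v: "(v, \<tau>) \<noteq> (u, \<sigma>)" "admissible_pair M v \<tau>" "v \<le> u"
      "supp (u - v) \<subseteq> \<tau>" "\<sigma> \<subseteq> \<tau>" by blast
    define e where "e = u - v"
    have u: "u = v + e" using v(3) by (simp add: e_def vec_eq_iff less_eq_vec_def)
    have e: "supp e \<subseteq> \<tau>" using v(4) by (simp add: e_def)
    have "\<tau> \<noteq> \<sigma>"
    proof
      assume "\<tau> = \<sigma>"
      moreover have "supp e \<subseteq> supp u" by (auto simp: supp_def e_def)
      ultimately have "supp e = {}" using e assms(1) by blast
      then have "e = 0" by (simp add: supp_def vec_eq_iff)
      with u v(1) \<open>\<tau> = \<sigma>\<close> show False by simp
    qed
    with v(5) obtain i where i: "i \<in> \<tau>" "i \<notin> \<sigma>" by blast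
    have "standard_monomial M (u + w)" if "supp w \<subseteq> \<sigma> \<union> {i}" for w
    proof -
      have "supp (e + w) \<subseteq> supp e \<union> supp w" by (auto simp: supp_def)
      with that e v(5) i(1) have "supp (e + w) \<subseteq> \<tau>" by blast
      with v(2) have "standard_monomial M (v + (e + w))" by (simp add: admissible_pair_def)
      then show ?thesis by (simp add: u add.assoc)
    qed
    with i show "\<exists>i\<in>- \<sigma>. ?std (\<sigma> \<union> {i})" by blast
  next
    assume "\<exists>i\<in>- \<sigma>. ?std (\<sigma> \<union> {i})"
    then obtain i where i: "i \<notin> \<sigma>" "?std (\<sigma> \<union> {i})" by blast
    define v where "v = (\<chi> j. if j = i then 0 else u $ j)"
    define e where "e = (\<chi> j. if j = i then u $ i else 0)"
    have u: "u = v + e" by (simp add: v_def e_def vec_eq_iff)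
    have std: "standard_monomial M (v + w)" if "supp w \<subseteq> \<sigma> \<union> {i}" for w
    proof -
      have "standard_monomial M ((v + w) + e)"
        using i(2)[rule_format, OF that] by (simp add: u add_ac)
      then show ?thesis unfolding M_def by (rule standard_monomial_divisor)
    qed
    have "standard_monomial M v" using std[of 0] by (simp add: supp_def)
    moreover have "supp v \<inter> (\<sigma> \<union> {i}) = {}" using assms(1) by (auto simp: supp_def v_def)
    ultimately have "admissible_pair M v (\<sigma> \<union> {i})" using std by (simp add: admissible_pair_def)
    moreover have "v \<le> u" by (simp add: v_def less_eq_vec_def)
    moreover have "supp (u - v) \<union> \<sigma> \<subseteq> \<sigma> \<union> {i}" by (auto simp: supp_def v_def split: if_splits)
    moreover have "(v, \<sigma> \<union> {i}) \<noteq> (u, \<sigma>)" using i(1) by auto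
    ultimately show "\<exists>v \<tau>. (v, \<tau>) \<noteq> (u, \<sigma>) \<and> admissible_pair M v \<tau> \<and> v \<le> u \<and>
        supp (u - v) \<union> \<sigma> \<subseteq> \<tau>" by blast
  qed
  show ?thesis unfolding standard_pair_def adm ex by simp
qed

section \<open>The circuit ideal\<close>

lemma circuit_ideal_eq:
  "circuit_ideal A = ideal_gen ((\<lambda>(p, q). monomial p - monomial q) `
    (\<lambda>c. (pos_part c, neg_part c)) ` {c. circuit A c})"
  unfolding circuit_ideal_def by (simp add: image_image lattice_binomial_def)

text \<open>
  The circuit ideal is homogeneous for the grading by \<open>A\<close>, so coefficient sums over the
  set of exponents of a given degree vanish on it; a binomial in the ideal must then have
  both terms in the same degree.
\<close>

lemma circuit_ideal_binomial_lattice: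
  fixes A :: "int ^ 'n::finite ^ 'd::finite"
  assumes "monomial p - monomial q \<in> (circuit_ideal A :: ('n, 'k::comm_ring_1) mpoly set)"
  shows "int_vec p - int_vec q \<in> relation_lattice A"
proof -
  let ?C = "{v. A *v int_vec v = A *v int_vec p}"
  have "coeff_sum ?C (monomial p - monomial q :: ('n, 'k) mpoly) = 0"
    using assms unfolding circuit_ideal_eq
  proof (rule coeff_sum_binomial_ideal)
    fix a b w
    assume "(a, b) \<in> (\<lambda>c. (pos_part c, neg_part c)) ` {c. circuit A c}"
    then obtain c where c: "circuit A c" "a = pos_part c" "b = neg_part c" by auto
    then have "int_vec (w + a) = int_vec (w + b) + c"
      by (auto simp: int_vec_def pos_part_def neg_part_def vec_eq_iff)
    then have "A *v int_vec (w + a) = A *v int_vec (w + b)"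
      using c(1) by (simp add: circuit_def relation_lattice_def matrix_vector_right_distrib)
    then show "w + a \<in> ?C \<longleftrightarrow> w + b \<in> ?C" by simp
  qed
  then have "A *v int_vec q = A *v int_vec p"
    by (simp add: coeff_sum_diff monomial_def coeff_sum_single split: if_splits)
  then show ?thesis by (simp add: relation_lattice_def matrix_vector_mult_diff_distrib)
qed

theorem theorem3p10:
  fixes A :: "int ^ 'n::finite ^ 'd::finite"
    and r :: nat
    and B :: "nat \<Rightarrow> int ^ 'n"
    and \<omega> :: "real ^ 'n"
    and u :: "nat ^ 'n"
    and \<sigma> :: "'n set"
    and IA IC :: "('n, 'k::alg_closed_field) mpoly set"
  defines "IA \<equiv> toric_ideal A"
    and "IC \<equiv> circuit_ideal A"
  assumes "rank (map_matrix real_of_int A) = CARD('d)"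
    and "relation_lattice A \<inter> {v. \<forall>i. 0 \<le> v $ i} = {0}"
    and "r = CARD('n) - CARD('d)"
    and "lattice_basis (relation_lattice A) r B"
    and "monomial_ideal (initial_ideal \<omega> IA)"
    and "monomial_ideal (initial_ideal \<omega> IC)"
    and "\<sigma> \<in> regular_triangulation A \<omega>"
    and "supp u \<inter> \<sigma> = {}"
  shows "standard_pair (initial_ideal \<omega> IC) u \<sigma> \<longleftrightarrow>
      (\<forall>z \<in> nonzero_lattice_points r (Q_polytope r B u \<omega> (- \<sigma>)).
          shift_binomial u (mat_app r B z) \<notin> saturation IC (var_prod \<sigma>)) \<and>
      (\<forall>i \<in> - \<sigma>. \<exists>z \<in> nonzero_lattice_points r (Q_polytope r B u \<omega> (- (\<sigma> \<union> {i}))).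
          shift_binomial u (mat_app r B z) \<in> saturation IC (var_prod (\<sigma> \<union> {i})))"

proof -
  have translates: "(\<forall>w. supp w \<subseteq> \<tau> \<longrightarrow> standard_monomial (initial_ideal \<omega> IC) (u + w)) \<longleftrightarrow>
    (\<forall>z\<in>nonzero_lattice_points r (Q_polytope r B u \<omega> (- \<tau>)).
      shift_binomial u (mat_app r B z) \<notin> saturation IC (var_prod \<tau>))" for \<tau>
    unfolding IC_def
    by (rule standard_translates_iff[OF circuit_ideal_eq assms(8)[unfolded IC_def] _ assms(6)])
      (rule circuit_ideal_binomial_lattice)
  show ?thesis
    unfolding standard_pair_iff_maximal[OF assms(10)] translates by blast
qed

end
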